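(* Let $G$ be a digraph and $\bar G$ the transitive closure of $G$. Let $\bar f$ be a discrete Morse function on $\bar G$, with discrete gradient vector field $\overline{V}$ and discrete gradient flow $\overline{\Phi}$ on $\bar G$. Suppose that $\Omega_*(G)$ is $\overline{V}$-invariant, i.e. $\overline{V}(\Omega_n(G))\subseteq\Omega_{n+1}(G)$ for all $n\ge0$, and that $\overline{\Phi}(\alpha)\in\Omega_*(G)$ for any $\alpha\in\mathrm{Crit}_*(\bar G)\cap P_*(G)$. Then for every $m\ge0$, $$H_m\big(\{\mathrm{Crit}_n(\bar G)\cap P_n(G),\tilde\partial_n\}_{n\ge0}\big)\cong H_m(G;\mathbb{R}),$$ where $\tilde\partial=(\overline{\Phi}^{\infty})^{-1}\circ\partial\circ\overline{\Phi}^{\infty}$ and $\overline{\Phi}^{\infty}$ is the stabilization map of $\overline{\Phi}$.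
   Context: A digraph $G$ consists of a finite vertex set $V$ and a non-empty edge set $E\subseteq V\times V\setminus\mathrm{diag}$; $(u,v)\in E$ is written $u\to v$. A digraph is transitive if for any two edges $u\to v$ and $v\to w$ there is an edge $u\to w$. The transitive closure $\bar G$ of $G$ is the smallest transitive digraph containing $G$ (same vertex set). $\Lambda_n(V)$ is the real vector space with basis all sequences $v_0\cdots v_n$ of vertices (elementary $n$-paths), with inner product $\langle\cdot,\cdot\rangle$ making elementary paths orthonormal. $\partial=\partial_n:\Lambda_n(V)\to\Lambda_{n-1}(V)$ is $\partial(v_0\cdots v_n)=\sum_{i=0}^n(-1)^i v_0\cdots\widehat{v_i}\cdots v_n$ (with $\partial_0=0$). For a digraph $G$, an allowed elementary $n$-path on $G$ is $v_0\cdots v_n$ with $v_{i-1}\to v_i$ an edge for $1\le i\le n$; $P_n(G)$ is their span, $\Omega_n(G)=\{x\in P_n(G):\partial x\in P_{n-1}(G)\}$, and the path homology is $H_m(G;\mathbb{R})=H_m(\{\Omega_n(G),\partial_n\}_{n\ge0})$. For allowed elementary paths, $\alpha>\beta$ (or $\beta<\alpha$) means $\beta$ is obtained from $\alpha$ by removing some vertices; a superscript $(n)$ indicates an $n$-path. For $f:V\to[0,+\infty)$ put $f(v_0\cdots v_n)=\sum_i f(v_i)$. $f$ is a discrete Morse function on a digraph if for every allowed elementary $\alpha^{(n)}$ on it, $\#\{\gamma^{(n+1)}>\alpha \mid f(\gamma)=f(\alpha)\}\le1$ and $\#\{\beta^{(n-1)}<\alpha \mid f(\beta)=f(\alpha)\}\le1$,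 with $\gamma,\beta$ allowed elementary paths on that digraph; $\alpha^{(n)}$ is critical if both numbers are $0$. $\mathrm{Crit}_n(\bar G)$ is the span of all critical $n$-paths of $\bar f$ on $\bar G$. $\overline{V}=\mathrm{grad}\bar f:P_n(\bar G)\to P_{n+1}(\bar G)$ is the linear map with $\overline{V}(\alpha)=-\langle\partial\gamma,\alpha\rangle\gamma$ if there is an allowed elementary $\gamma^{(n+1)}>\alpha^{(n)}$ on $\bar G$ with $\bar f(\gamma)=\bar f(\alpha)$, and $\overline{V}(\alpha)=0$ otherwise. The discrete gradient flow is $\overline{\Phi}=\mathrm{Id}+\partial\overline{V}+\overline{V}\partial$ on $P_*(\bar G)$. The stabilization map $\overline{\Phi}^\infty$ is the common value $\overline{\Phi}^N=\overline{\Phi}^{N+1}=\cdots$ for $N$ large. Put $P_n^{\overline\Phi}(\bar G)=\{x\in P_n(\bar G):\overline\Phi(x)=x\}$. In the definition of $\tilde\partial$, $\overline{\Phi}^\infty$ denotes its restriction $\mathrm{Crit}_n(\bar G)\cap P_n(G)\to P_n^{\overline\Phi}(\bar G)\cap\Omega_n(G)$, which under the stated hypotheses is an isomorphism, and $(\overline{\Phi}^\infty)^{-1}$ is the inverse of this restriction. *)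

theory Defs
  imports
    "HOL-Analysis.Finite_Function_Topology"
    "HOL-Library.Sublist"
    "HOL-Algebra.Module"
    "Graph_Theory.Pair_Digraph"
begin

section \<open>Digraphs and transitive closure\<close>

text \<open>\<open>pair_digraph\<close> provides a finite vertex set and arcs that are ordered pairs of distinct
  vertices.\<close>

definition path_digraph :: "'v pair_pre_digraph \<Rightarrow> bool" where
  "path_digraph G \<longleftrightarrow> pair_digraph G \<and> parcs G \<noteq> {}"

definition transitive_digraph :: "'v pair_pre_digraph \<Rightarrow> bool" where
  "transitive_digraph G \<longleftrightarrow> path_digraph G \<and> trans (parcs G)"

text \<open>Transitivity is not restricted to distinct end points: \<open>u \<rightarrow> v \<rightarrow> u\<close> would force a loop
  at \<open>u\<close>, so a digraph with a directed cycle has no transitive closure in this sense.\<close>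

definition is_transitive_closure :: "'v pair_pre_digraph \<Rightarrow> 'v pair_pre_digraph \<Rightarrow> bool" where
  "is_transitive_closure H G \<longleftrightarrow>
     transitive_digraph H \<and> pverts H = pverts G \<and> parcs G \<subseteq> parcs H \<and>
     (\<forall>K. transitive_digraph K \<and> pverts K = pverts G \<and> parcs G \<subseteq> parcs K \<longrightarrow>
          parcs H \<subseteq> parcs K)"


section \<open>Paths, boundary and the path complex\<close>

text \<open>An elementary \<open>n\<close>-path is a vertex list of length \<open>n + 1\<close>. Chains of all degrees live in the
  one type \<open>'v chain\<close>; elements of the \<open>n\<close>th space are supported on lists of length \<open>n + 1\<close>.\<close>

type_synonym 'v chain = "'v list \<Rightarrow>\<^sub>0 real"

abbreviation elem :: "'v list \<Rightarrow> 'v chain" where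
  "elem p \<equiv> Poly_Mapping.single p 1"

definition chain_inner :: "'v chain \<Rightarrow> 'v chain \<Rightarrow> real" where
  "chain_inner x y =
     (\<Sum>p\<in>Poly_Mapping.keys x. Poly_Mapping.lookup x p * Poly_Mapping.lookup y p)"

definition lin_ext :: "('v list \<Rightarrow> 'v chain) \<Rightarrow> 'v chain \<Rightarrow> 'v chain" where
  "lin_ext g x = (\<Sum>p\<in>Poly_Mapping.keys x. Poly_Mapping.lookup x p *\<^sub>R g p)"

text \<open>The case distinction is the convention \<open>\<partial>\<^sub>0 = 0\<close>: the complex is not augmented.\<close>

definition boundary_elem :: "'v list \<Rightarrow> 'v chain" where
  "boundary_elem p =
     (if length p \<le> 1 then 0
      else \<Sum>i<length p. (- 1) ^ i *\<^sub>R elem (take i p @ drop (Suc i) p))"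

definition boundary :: "'v chain \<Rightarrow> 'v chain" where
  "boundary = lin_ext boundary_elem"

definition allowed_path :: "'v pair_pre_digraph \<Rightarrow> 'v list \<Rightarrow> bool" where
  "allowed_path G p \<longleftrightarrow>
     p \<noteq> [] \<and> set p \<subseteq> pverts G \<and> successively (\<lambda>u v. (u, v) \<in> parcs G) p"

definition P_space :: "'v pair_pre_digraph \<Rightarrow> nat \<Rightarrow> 'v chain set" where
  "P_space G n = span (elem ` {p. allowed_path G p \<and> length p = Suc n})"

text \<open>In degree 0 the condition on the boundary holds trivially, since \<open>\<partial>\<^sub>0 = 0\<close>; the truncated
  index \<open>0 - 1 = 0\<close> is harmless there.\<close>

definition Omega_space :: "'v pair_pre_digraph \<Rightarrow> nat \<Rightarrow> 'v chain set" where
  "Omega_space G n = {x \<in> P_space G n. boundary x \<in> P_space G (n - 1)}"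


section \<open>Discrete Morse functions\<close>

definition path_value :: "('v \<Rightarrow> real) \<Rightarrow> 'v list \<Rightarrow> real" where
  "path_value f p = sum_list (map f p)"

definition equal_cofaces :: "'v pair_pre_digraph \<Rightarrow> ('v \<Rightarrow> real) \<Rightarrow> 'v list \<Rightarrow> 'v list set" where
  "equal_cofaces G f \<alpha> =
     {\<gamma>. allowed_path G \<gamma> \<and> length \<gamma> = Suc (length \<alpha>) \<and> strict_subseq \<alpha> \<gamma> \<and>
          path_value f \<gamma> = path_value f \<alpha>}"

definition equal_faces :: "'v pair_pre_digraph \<Rightarrow> ('v \<Rightarrow> real) \<Rightarrow> 'v list \<Rightarrow> 'v list set" where
  "equal_faces G f \<alpha> =
     {\<beta>. allowed_path G \<beta> \<and> length \<alpha> = Suc (length \<beta>) \<and> strict_subseq \<beta> \<alpha> \<and>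
          path_value f \<beta> = path_value f \<alpha>}"

definition discrete_morse :: "'v pair_pre_digraph \<Rightarrow> ('v \<Rightarrow> real) \<Rightarrow> bool" where
  "discrete_morse G f \<longleftrightarrow>
     (\<forall>v\<in>pverts G. 0 \<le> f v) \<and>
     (\<forall>\<alpha>. allowed_path G \<alpha> \<longrightarrow>
          card (equal_cofaces G f \<alpha>) \<le> 1 \<and> card (equal_faces G f \<alpha>) \<le> 1)"

definition critical_path :: "'v pair_pre_digraph \<Rightarrow> ('v \<Rightarrow> real) \<Rightarrow> 'v list \<Rightarrow> bool" where
  "critical_path G f \<alpha> \<longleftrightarrow>
     allowed_path G \<alpha> \<and> equal_cofaces G f \<alpha> = {} \<and> equal_faces G f \<alpha> = {}"

definition Crit_space :: "'v pair_pre_digraph \<Rightarrow> ('v \<Rightarrow> real) \<Rightarrow> nat \<Rightarrow> 'v chain set" where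
  "Crit_space G f n = span (elem ` {\<alpha>. critical_path G f \<alpha> \<and> length \<alpha> = Suc n})"


section \<open>Gradient vector field, gradient flow, stabilization\<close>

text \<open>For a discrete Morse function the coface selected by \<open>THE\<close> is unique.\<close>

definition grad_elem :: "'v pair_pre_digraph \<Rightarrow> ('v \<Rightarrow> real) \<Rightarrow> 'v list \<Rightarrow> 'v chain" where
  "grad_elem G f \<alpha> =
     (if allowed_path G \<alpha> \<and> equal_cofaces G f \<alpha> \<noteq> {}
      then let \<gamma> = (THE \<gamma>. \<gamma> \<in> equal_cofaces G f \<alpha>)
           in (- chain_inner (boundary (elem \<gamma>)) (elem \<alpha>)) *\<^sub>R elem \<gamma>
      else 0)"

definition grad :: "'v pair_pre_digraph \<Rightarrow> ('v \<Rightarrow> real) \<Rightarrow> 'v chain \<Rightarrow> 'v chain" where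
  "grad G f = lin_ext (grad_elem G f)"

definition flow :: "'v pair_pre_digraph \<Rightarrow> ('v \<Rightarrow> real) \<Rightarrow> 'v chain \<Rightarrow> 'v chain" where
  "flow G f x = x + boundary (grad G f x) + grad G f (boundary x)"

text \<open>The iterates are compared only on allowed chains, the domain of the flow.\<close>

definition flow_infty :: "'v pair_pre_digraph \<Rightarrow> ('v \<Rightarrow> real) \<Rightarrow> 'v chain \<Rightarrow> 'v chain" where
  "flow_infty G f =
     flow G f ^^ (LEAST N. \<forall>k\<ge>N. \<forall>n. \<forall>x\<in>P_space G n. (flow G f ^^ k) x = (flow G f ^^ N) x)"


section \<open>Homology as a real vector space\<close>

text \<open>A complex is given by subspaces \<open>C n\<close> of a common vector space and maps
  \<open>d n\<close> from \<open>C n\<close> to \<open>C (n - 1)\<close>; \<open>d 0\<close> is meant to vanish on \<open>C 0\<close>. Homology is the quotient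
  of cycles by boundaries, with cosets as elements. The set of boundaries is added in the scalar
  multiplication so that \<open>0\<close> times a coset is the zero coset rather than \<open>{0}\<close>. The fields
  \<open>mult\<close> and \<open>one\<close>, which the record type inherits from rings, play no role for modules.\<close>

definition cycles :: "(nat \<Rightarrow> 'a::real_vector set) \<Rightarrow> (nat \<Rightarrow> 'a \<Rightarrow> 'a) \<Rightarrow> nat \<Rightarrow> 'a set" where
  "cycles C d m = {x \<in> C m. d m x = 0}"

definition boundaries :: "(nat \<Rightarrow> 'a::real_vector set) \<Rightarrow> (nat \<Rightarrow> 'a \<Rightarrow> 'a) \<Rightarrow> nat \<Rightarrow> 'a set" where
  "boundaries C d m = d (Suc m) ` C (Suc m)"

definition homology ::
    "(nat \<Rightarrow> 'a::real_vector set) \<Rightarrow> (nat \<Rightarrow> 'a \<Rightarrow> 'a) \<Rightarrow> nat \<Rightarrow> (real, 'a set) module" where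
  "homology C d m =
     \<lparr>carrier = (\<lambda>z. {z + b | b. b \<in> boundaries C d m}) ` cycles C d m,
      monoid.mult = undefined, one = undefined,
      zero = boundaries C d m,
      add = (\<lambda>X Y. {x + y | x y. x \<in> X \<and> y \<in> Y}),
      smult = (\<lambda>r X. {r *\<^sub>R x + b | x b. x \<in> X \<and> b \<in> boundaries C d m})\<rparr>"

definition real_module_iso :: "(real, 'a) module \<Rightarrow> (real, 'b) module \<Rightarrow> bool" where
  "real_module_iso M N \<longleftrightarrow>
     (\<exists>\<phi>. bij_betw \<phi> (carrier M) (carrier N) \<and>
          (\<forall>x\<in>carrier M. \<forall>y\<in>carrier M. \<phi> (x \<oplus>\<^bsub>M\<^esub> y) = \<phi> x \<oplus>\<^bsub>N\<^esub> \<phi> y) \<and>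
          (\<forall>r. \<forall>x\<in>carrier M. \<phi> (r \<odot>\<^bsub>M\<^esub> x) = r \<odot>\<^bsub>N\<^esub> \<phi> x))"

definition path_homology :: "'v pair_pre_digraph \<Rightarrow> nat \<Rightarrow> (real, 'v chain set) module" where
  "path_homology G m = homology (Omega_space G) (\<lambda>n. boundary) m"


section \<open>The Morse complex of a subdigraph\<close>

text \<open>\<open>H\<close> is the ambient digraph carrying the Morse function, \<open>G\<close> the subdigraph.\<close>

definition morse_space ::
    "'v pair_pre_digraph \<Rightarrow> 'v pair_pre_digraph \<Rightarrow> ('v \<Rightarrow> real) \<Rightarrow> nat \<Rightarrow> 'v chain set" where
  "morse_space G H f n = Crit_space H f n \<inter> P_space G n"

definition morse_boundary ::
    "'v pair_pre_digraph \<Rightarrow> 'v pair_pre_digraph \<Rightarrow> ('v \<Rightarrow> real) \<Rightarrow> nat \<Rightarrow> 'v chain \<Rightarrow> 'v chain" where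
  "morse_boundary G H f n x =
     (case n of
        0 \<Rightarrow> 0
      | Suc k \<Rightarrow> inv_into (morse_space G H f k) (flow_infty H f) (boundary (flow_infty H f x)))"

end

theory Submission
  imports Defs
begin

text \<open>Inserting a vertex into a path preserves the value of \<open>f\<close> exactly when \<open>f\<close> vanishes there,
  so the Morse condition on a transitive digraph says that a path of positive length contains at
  most one zero of \<open>f\<close> and that at most one zero can be inserted into a path. This gives
  \<open>V V = 0\<close> and \<open>V \<partial> V = - V\<close>, hence \<open>\<Phi> = 1 + \<partial> V + V \<partial>\<close> is idempotent: it is its own
  stabilization, and \<open>V\<close> is a chain homotopy between \<open>\<Phi>\<close> and the identity of the invariant complex
  \<open>\<Omega>(G)\<close>. Projecting to the critical paths inverts \<open>\<Phi>\<close> from the critical chains in \<open>P(G)\<close> onto the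
  fixed points of \<open>\<Phi>\<close> in \<open>\<Omega>(G)\<close>, because \<open>V x = 0\<close> for a fixed point \<open>x\<close> and \<open>\<Phi>\<close> kills every path
  that has an equal face.\<close>

section \<open>Linear maps on chains\<close>

lemma lookup_scaleR [simp]:
  "Poly_Mapping.lookup (r *\<^sub>R x) p = r *\<^sub>R Poly_Mapping.lookup x p"
proof -
  \<comment> \<open>Scalar multiplication is defined through the abstraction function, whose
    coefficients are known only once the support is finite.\<close>
  have "finite {i. r *\<^sub>R Poly_Mapping.lookup x i \<noteq> 0}"
    by (rule finite_subset[OF _ finite_lookup[of x]]) auto
  then show ?thesis
    by (simp add: scaleR_poly_mapping_def)
qed

text \<open>Indices outside the keys have coefficient zero. A common index set lets the sums for two
  chains and for their sum be compared term by term.\<close>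

lemma lin_ext_superset:
  assumes "finite A" "Poly_Mapping.keys x \<subseteq> A"
  shows "lin_ext g x = (\<Sum>p\<in>A. Poly_Mapping.lookup x p *\<^sub>R g p)"
  unfolding lin_ext_def
  by (rule sum.mono_neutral_left) (use assms in \<open>auto simp: in_keys_iff\<close>)

lemma linear_lin_ext: "linear (lin_ext g)"
proof (rule linearI)
  fix x y :: "'a chain" and r :: real
  let ?A = "Poly_Mapping.keys x \<union> Poly_Mapping.keys y"
  have fin: "finite ?A" by simp
  have "Poly_Mapping.keys (x + y) \<subseteq> ?A"
    by (rule Poly_Mapping.keys_add)
  then show "lin_ext g (x + y) = lin_ext g x + lin_ext g y"
    by (simp add: lin_ext_superset[OF fin] lookup_add scaleR_add_left sum.distrib)
  have "Poly_Mapping.keys (r *\<^sub>R x) \<subseteq> Poly_Mapping.keys x"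
    by (auto simp: in_keys_iff)
  then show "lin_ext g (r *\<^sub>R x) = r *\<^sub>R lin_ext g x"
    by (simp add: lin_ext_superset[OF finite_keys[of x]] scaleR_sum_right)
qed

lemma lin_ext_elem [simp]: "lin_ext g (elem p) = g p"
  by (simp add: lin_ext_def)

lemma chain_expansion:
  "x = (\<Sum>p\<in>Poly_Mapping.keys x. Poly_Mapping.lookup x p *\<^sub>R elem p)" for x :: "'v chain"
proof (rule poly_mapping_eqI)
  fix q
  show "Poly_Mapping.lookup x q =
    Poly_Mapping.lookup (\<Sum>p\<in>Poly_Mapping.keys x. Poly_Mapping.lookup x p *\<^sub>R elem p) q"
    by (simp add: lookup_sum lookup_single when_def if_distrib in_keys_iff cong: if_cong)
qed

text \<open>Agreement is asked only on the paths occurring in \<open>x\<close>, so that properties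
  such as being allowed or critical can be used for each of them.\<close>

lemma linear_eq_on_keys:
  fixes x :: "'v chain"
  assumes "linear g" "linear h" "\<And>p. p \<in> Poly_Mapping.keys x \<Longrightarrow> g (elem p) = h (elem p)"
  shows "g x = h x"
proof -
  have "k x = (\<Sum>p\<in>Poly_Mapping.keys x. Poly_Mapping.lookup x p *\<^sub>R k (elem p))"
    if "linear k" for k :: "'v chain \<Rightarrow> _"
    using arg_cong[OF chain_expansion, of k x]
    by (simp only: linear_sum[OF that] linear_scale[OF that])
  from this[OF assms(1)] this[OF assms(2)] show ?thesis
    using assms(3) by simp
qed

text \<open>Turns each space defined as a span into a condition on supports.\<close>

lemma span_elem: "span (elem ` S) = {x. Poly_Mapping.keys x \<subseteq> S}"
proof (rule equalityI)
  have "subspace {x :: 'a chain. Poly_Mapping.keys x \<subseteq> S}"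
  proof (rule subspaceI)
    fix x y :: "'a chain" and r :: real
    assume x: "x \<in> {x. Poly_Mapping.keys x \<subseteq> S}"
    then show "r *\<^sub>R x \<in> {x. Poly_Mapping.keys x \<subseteq> S}"
      by (auto simp: in_keys_iff)
    assume "y \<in> {x. Poly_Mapping.keys x \<subseteq> S}"
    with x show "x + y \<in> {x. Poly_Mapping.keys x \<subseteq> S}"
      using Poly_Mapping.keys_add[of x y] by auto
  qed simp
  then show "span (elem ` S) \<subseteq> {x. Poly_Mapping.keys x \<subseteq> S}"
    by (rule span_minimal[rotated]) auto
  show "{x. Poly_Mapping.keys x \<subseteq> S} \<subseteq> span (elem ` S)"
  proof
    fix x :: "'a chain"
    assume "x \<in> {x. Poly_Mapping.keys x \<subseteq> S}"
    then have "(\<Sum>p\<in>Poly_Mapping.keys x. Poly_Mapping.lookup x p *\<^sub>R elem p) \<in> span (elem ` S)"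
      by (intro span_sum span_scale span_base) auto
    then show "x \<in> span (elem ` S)"
      by (simp flip: chain_expansion)
  qed
qed

lemma P_space_iff:
  "x \<in> P_space G n \<longleftrightarrow> Poly_Mapping.keys x \<subseteq> {p. allowed_path G p \<and> length p = Suc n}"
  by (simp add: P_space_def span_elem)

lemma Crit_space_iff:
  "x \<in> Crit_space H f n \<longleftrightarrow> Poly_Mapping.keys x \<subseteq> {p. critical_path H f p \<and> length p = Suc n}"
  by (simp add: Crit_space_def span_elem)

lemma subspace_P_space: "subspace (P_space G n)"
  by (simp add: P_space_def)

lemma linear_boundary: "linear boundary"
  by (simp add: boundary_def linear_lin_ext)

lemma linear_grad: "linear (grad H f)"
  by (simp add: grad_def linear_lin_ext)

lemma linear_flow: "linear (flow H f)"
proof -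
  have "linear (\<lambda>x. x + boundary (grad H f x) + grad H f (boundary x))"
    by (intro linear_compose_add linear_ident
        linear_compose[OF linear_grad linear_boundary, unfolded o_def]
        linear_compose[OF linear_boundary linear_grad, unfolded o_def])
  then show ?thesis
    by (simp add: flow_def[abs_def])
qed

lemma subspace_Omega_space: "subspace (Omega_space G n)"
proof -
  have "Omega_space G n = P_space G n \<inter> (boundary -` P_space G (n - 1))"
    by (auto simp: Omega_space_def)
  then show ?thesis
    by (simp add: subspace_inter subspace_P_space linear_subspace_vimage linear_boundary)
qed

section \<open>The boundary of a boundary\<close>

abbreviation face :: "nat \<Rightarrow> 'a list \<Rightarrow> 'a list" where
  "face i p \<equiv> take i p @ drop (Suc i) p"

text \<open>The simplicial identity: once position \<open>j\<close> is gone, the entry formerly at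
  \<open>i\<close> sits at \<open>i - 1\<close>.\<close>

lemma face_face:
  assumes "j < i" "i < length p"
  shows "face j (face i p) = face (i - 1) (face j p)"
proof (rule nth_equalityI)
  show "length (face j (face i p)) = length (face (i - 1) (face j p))"
    using assms by auto
  fix k
  assume k: "k < length (face j (face i p))"
  obtain m where "i = Suc (j + m)"
    using assms less_imp_Suc_add by blast
  then show "face j (face i p) ! k = face (i - 1) (face j p) ! k"
    using assms k by (auto simp: nth_append min_def)
qed

lemma boundary_elem [simp]: "boundary (elem p) = boundary_elem p"
  by (simp add: boundary_def)

text \<open>Any two positions are removed in both orders, with opposite signs.\<close>

lemma boundary_boundary: "boundary (boundary x) = 0"
proof -
  have "boundary (boundary (elem p)) = 0" for p :: "'a list"
  \<comment> \<open>Here the faces have at most one vertex, so their boundary is zero by the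
    convention in degree 0; a cancellation argument would involve the empty list.\<close>
  proof (cases "length p \<le> 2")
    case True
    have "boundary_elem (face i p) = 0" if "i < length p" for i
      using True that by (auto simp: boundary_elem_def)
    then show ?thesis
      by (simp add: boundary_elem_def[of p] linear_0[OF linear_boundary]
          linear_sum[OF linear_boundary] linear_scale[OF linear_boundary])
  next
    case False
    define n where "n = length p - 1"
    have n: "length p = Suc n" "n > 1"
      using False by (auto simp: n_def)
    define t where "t = (\<lambda>(i, j). (- 1) ^ (i + j) *\<^sub>R elem (face j (face i p)) :: 'a chain)"
    let ?L = "{(i, j). j < i \<and> i < Suc n}" and ?R = "{(i, j). i \<le> j \<and> j < n}"
    have be: "boundary_elem q = (\<Sum>j<length q. (- 1) ^ j *\<^sub>R elem (face j q))"
      if "length q > 1" for q :: "'a list"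
      using that by (simp add: boundary_elem_def)
    have len: "length (face i p) = n" if "i < Suc n" for i
      using that n by auto
    have inner: "(- 1) ^ i *\<^sub>R boundary_elem (face i p) = (\<Sum>j<n. t (i, j))" if "i < Suc n" for i
      unfolding be[of "face i p", unfolded len[OF that], OF n(2)] t_def
      by (simp add: scaleR_sum_right power_add)
    have "boundary (boundary (elem p)) =
        boundary (\<Sum>i<Suc n. (- 1) ^ i *\<^sub>R elem (face i p))"
      using be[of p] n by (simp only: boundary_elem n(1))
    also have "\<dots> = (\<Sum>i<Suc n. (- 1) ^ i *\<^sub>R boundary_elem (face i p))"
      by (simp only: linear_sum[OF linear_boundary] linear_scale[OF linear_boundary] boundary_elem)
    also have "\<dots> = (\<Sum>i<Suc n. \<Sum>j<n. t (i, j))"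
      by (rule sum.cong[OF refl]) (simp only: inner lessThan_iff)
    also have "\<dots> = (\<Sum>z\<in>{..<Suc n} \<times> {..<n}. t z)"
      by (simp only: sum.cartesian_product case_prod_eta)
    also have "{..<Suc n} \<times> {..<n} = ?L \<union> ?R"
      using n by auto
    also have "(\<Sum>z\<in>?L \<union> ?R. t z) = (\<Sum>z\<in>?L. t z) + (\<Sum>z\<in>?R. t z)"
    proof (rule sum.union_disjoint)
      show "finite ?L"
        by (rule finite_subset[of _ "{..<Suc n} \<times> {..<Suc n}"]) auto
      show "finite ?R"
        by (rule finite_subset[of _ "{..<Suc n} \<times> {..<Suc n}"]) auto
    qed auto
    also have "(\<Sum>z\<in>?L. t z) = (\<Sum>z\<in>?R. - t z)"
    \<comment> \<open>The pair \<open>(i, j)\<close> with \<open>j < i\<close> is matched with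
      \<open>(j, i - 1)\<close>: the same list remains, and the index sum drops by one, which flips
      the sign.\<close>
    proof (rule sum.reindex_bij_witness[of _ "\<lambda>(i, j). (Suc j, i)" "\<lambda>(i, j). (j, i - 1)"])
      fix z assume "z \<in> ?L"
      then obtain i j where z: "z = (i, j)" "j < i" "i < Suc n" by auto
      then have "i + j = Suc (j + (i - 1))" by simp
      then have sign: "(- 1 :: real) ^ (i + j) = - ((- 1) ^ (j + (i - 1)))"
        by (simp only: power_Suc mult_minus1)
      have "face j (face i p) = face (i - 1) (face j p)"
        by (rule face_face) (use z n in auto)
      then show "- t ((\<lambda>(i, j). (j, i - 1)) z) = t z"
        by (simp only: z(1) prod.case t_def sign scaleR_minus_left)
    qed auto
    finally show ?thesis
      by (simp add: sum_negf)
  qed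
  then show ?thesis
    by (rule linear_eq_on_keys[where g = "\<lambda>x. boundary (boundary x)" and h = "\<lambda>_. 0",
          OF linear_compose[OF linear_boundary linear_boundary, unfolded o_def] linear_zero])
qed

lemma boundary_P_space_0: "x \<in> P_space G 0 \<Longrightarrow> boundary x = 0"
  by (rule linear_eq_on_keys[OF linear_boundary linear_zero])
    (auto simp: P_space_iff boundary_elem_def)

lemma boundary_Omega_space: "x \<in> Omega_space G n \<Longrightarrow> boundary x \<in> Omega_space G (n - 1)"
  by (simp add: Omega_space_def boundary_boundary subspace_0 subspace_P_space)

section \<open>Isomorphisms in homology\<close>

definition coset :: "'a::real_vector set \<Rightarrow> 'a \<Rightarrow> 'a set" where
  "coset B z = {z + b | b. b \<in> B}"

lemma in_coset_iff: "x \<in> coset B z \<longleftrightarrow> x - z \<in> B"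
  unfolding coset_def by (auto intro: exI[of _ "x - z"])

lemma coset_eq_iff:
  assumes "subspace B"
  shows "coset B z = coset B w \<longleftrightarrow> z - w \<in> B"
proof
  assume "coset B z = coset B w"
  moreover have "z \<in> coset B z"
    by (simp add: in_coset_iff subspace_0 assms)
  ultimately show "z - w \<in> B"
    by (simp add: in_coset_iff)
next
  assume "z - w \<in> B"
  then have "x - z \<in> B \<longleftrightarrow> x - w \<in> B" for x
    using subspace_add[OF assms, of "x - z" "z - w"] subspace_diff[OF assms, of "x - w" "z - w"]
    by auto
  then show "coset B z = coset B w"
    by (auto simp: in_coset_iff)
qed

lemma coset_add:
  assumes "subspace B"
  shows "{x + y | x y. x \<in> coset B z \<and> y \<in> coset B w} = coset B (z + w)"
proof (intro equalityI subsetI)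
  fix u assume "u \<in> {x + y | x y. x \<in> coset B z \<and> y \<in> coset B w}"
  then obtain x y where "u = x + y" "x - z \<in> B" "y - w \<in> B"
    by (auto simp: in_coset_iff)
  then show "u \<in> coset B (z + w)"
    using subspace_add[OF assms, of "x - z" "y - w"] by (simp add: in_coset_iff algebra_simps)
next
  fix u assume "u \<in> coset B (z + w)"
  then have "u = (u - w) + w" "u - w \<in> coset B z" "w \<in> coset B w"
    by (auto simp: in_coset_iff algebra_simps subspace_0 assms)
  then show "u \<in> {x + y | x y. x \<in> coset B z \<and> y \<in> coset B w}"
    by blast
qed

lemma coset_scale:
  assumes "subspace B"
  shows "{r *\<^sub>R x + b | x b. x \<in> coset B z \<and> b \<in> B} = coset B (r *\<^sub>R z)"
proof (intro equalityI subsetI)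
  fix u assume "u \<in> {r *\<^sub>R x + b | x b. x \<in> coset B z \<and> b \<in> B}"
  then obtain x b where "u = r *\<^sub>R x + b" "x - z \<in> B" "b \<in> B"
    by (auto simp: in_coset_iff)
  then show "u \<in> coset B (r *\<^sub>R z)"
    using subspace_add[OF assms subspace_scale[OF assms, of "x - z" r], of b]
    by (simp add: in_coset_iff algebra_simps)
next
  fix u assume "u \<in> coset B (r *\<^sub>R z)"
  then have "u = r *\<^sub>R z + (u - r *\<^sub>R z)" "z \<in> coset B z" "u - r *\<^sub>R z \<in> B"
    by (auto simp: in_coset_iff subspace_0 assms)
  then show "u \<in> {r *\<^sub>R x + b | x b. x \<in> coset B z \<and> b \<in> B}"
    by blast
qed

text \<open>The hypotheses concern cycles and boundaries instead of linearity of the differentials,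
  because \<open>morse_boundary\<close> is built from \<open>inv_into\<close> and is controlled only
  on \<open>morse_space\<close>.\<close>

lemma real_module_iso_homology:
  fixes g :: "'a::real_vector \<Rightarrow> 'b::real_vector"
  assumes g: "linear g"
    and ZC: "subspace (cycles C d m)"
    and BC: "subspace (boundaries C d m)"
    and BD: "subspace (boundaries D e m)"
    and cyc: "\<And>x. x \<in> cycles C d m \<Longrightarrow> g x \<in> cycles D e m"
    and bnd: "\<And>x. x \<in> boundaries C d m \<Longrightarrow> g x \<in> boundaries D e m"
    and inj: "\<And>x. x \<in> cycles C d m \<Longrightarrow> g x \<in> boundaries D e m \<Longrightarrow> x \<in> boundaries C d m"
    and surj: "\<And>y. y \<in> cycles D e m \<Longrightarrow> \<exists>x\<in>cycles C d m. g x - y \<in> boundaries D e m"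
  shows "real_module_iso (homology C d m) (homology D e m)"
proof -
  let ?BC = "boundaries C d m" and ?BD = "boundaries D e m"
  \<comment> \<open>Adding the boundaries of the target fills up the coset; the plain image of a
    coset under \<open>g\<close> may be only part of one.\<close>
  define \<phi> where "\<phi> X = {g x + b | x b. x \<in> X \<and> b \<in> ?BD}" for X
  have \<phi>: "\<phi> (coset ?BC z) = coset ?BD (g z)" for z
  proof (intro equalityI subsetI)
    fix u assume "u \<in> \<phi> (coset ?BC z)"
    then obtain x b where u: "u = g x + b" "x - z \<in> ?BC" "b \<in> ?BD"
      by (auto simp: \<phi>_def in_coset_iff)
    then have "g (x - z) + b \<in> ?BD"
      by (intro subspace_add BD bnd)
    then show "u \<in> coset ?BD (g z)"
      using u by (simp add: in_coset_iff linear_diff[OF g] algebra_simps)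
  next
    fix u assume "u \<in> coset ?BD (g z)"
    then have "u = g z + (u - g z)" "z \<in> coset ?BC z" "u - g z \<in> ?BD"
      by (auto simp: in_coset_iff subspace_0 BC)
    then show "u \<in> \<phi> (coset ?BC z)"
      unfolding \<phi>_def by blast
  qed
  have carC: "carrier (homology C d m) = coset ?BC ` cycles C d m"
    and carD: "carrier (homology D e m) = coset ?BD ` cycles D e m"
    by (auto simp: homology_def coset_def)
  have "bij_betw \<phi> (carrier (homology C d m)) (carrier (homology D e m))"
  proof (rule bij_betwI')
    fix X Y assume "X \<in> carrier (homology C d m)" "Y \<in> carrier (homology C d m)"
    then obtain z w where zw: "X = coset ?BC z" "Y = coset ?BC w"
        "z \<in> cycles C d m" "w \<in> cycles C d m"
      by (auto simp: carC)
    have "z - w \<in> ?BC \<longleftrightarrow> g (z - w) \<in> ?BD"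
      using inj[of "z - w"] bnd zw subspace_diff[OF ZC] by blast
    then show "\<phi> X = \<phi> Y \<longleftrightarrow> X = Y"
      by (simp add: zw \<phi> coset_eq_iff BC BD linear_diff[OF g])
  next
    fix X assume "X \<in> carrier (homology C d m)"
    then show "\<phi> X \<in> carrier (homology D e m)"
      using cyc by (auto simp: carC carD \<phi>)
  next
    fix Y assume "Y \<in> carrier (homology D e m)"
    then obtain y where y: "Y = coset ?BD y" "y \<in> cycles D e m"
      by (auto simp: carD)
    with surj obtain x where "x \<in> cycles C d m" "g x - y \<in> ?BD"
      by blast
    then show "\<exists>X\<in>carrier (homology C d m). Y = \<phi> X"
      by (metis \<phi> carC coset_eq_iff[OF BD] image_eqI y(1))
  qed
  moreover have "\<phi> (X \<oplus>\<^bsub>homology C d m\<^esub> Y) = \<phi> X \<oplus>\<^bsub>homology D e m\<^esub> \<phi> Y"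
    if XY: "X \<in> carrier (homology C d m)" "Y \<in> carrier (homology C d m)" for X Y
  proof -
    obtain z w where zw: "X = coset ?BC z" "Y = coset ?BC w"
      using XY by (auto simp: carC)
    show ?thesis
      unfolding zw by (simp add: homology_def coset_add BC BD \<phi> linear_add[OF g])
  qed
  moreover have "\<phi> (r \<odot>\<^bsub>homology C d m\<^esub> X) = r \<odot>\<^bsub>homology D e m\<^esub> \<phi> X"
    if X: "X \<in> carrier (homology C d m)" for r X
  proof -
    obtain z where z: "X = coset ?BC z"
      using X by (auto simp: carC)
    show ?thesis
      unfolding z by (simp add: homology_def coset_scale BC BD \<phi> linear_scale[OF g])
  qed
  ultimately show ?thesis
    unfolding real_module_iso_def by blast
qed

section \<open>Morse functions on a transitive digraph\<close>

lemma split_at_nth: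
  assumes "i < length p"
  obtains xs x ys where "p = xs @ x # ys" "length xs = i" "p ! i = x" "face i p = xs @ ys"
  using id_take_nth_drop[OF assms] assms by (intro that[of "take i p" "p ! i" "drop (Suc i) p"]) auto

text \<open>Links the order on paths, given by subsequences, to the indexed faces in the
  boundary.\<close>

lemma subseq_codim1_iff:
  "subseq q p \<and> length p = Suc (length q) \<longleftrightarrow> (\<exists>i<length p. q = face i p)"
proof (intro iffI)
  assume "\<exists>i<length p. q = face i p"
  then obtain i where i: "i < length p" and q: "q = face i p"
    by blast
  obtain xs x ys where "p = xs @ x # ys" "q = xs @ ys"
    by (rule split_at_nth[OF i]) (simp only: q)
  then show "subseq q p \<and> length p = Suc (length q)"
    by (auto simp: subseq_append')
next
  assume "subseq q p \<and> length p = Suc (length q)"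
  then show "\<exists>i<length p. q = face i p"
  proof (induction p arbitrary: q)
    case (Cons a p)
    show ?case
    proof (cases "q = p")
      case False
      from Cons.prems have "subseq q (a # p)" "length q = length p"
        by auto
      \<comment> \<open>If the head \<open>a\<close> were skipped, \<open>q\<close> would be a
        subsequence of \<open>p\<close> of the same length, hence equal to \<open>p\<close>.\<close>
      moreover from this False obtain q' where q': "q = a # q'" "subseq q' p"
        by (cases rule: list_emb.cases) (auto dest: subseq_same_length)
      ultimately obtain i where "i < length p" "q' = face i p"
        using Cons.IH[of q'] by auto
      then show ?thesis
        using q' by (intro exI[of _ "Suc i"]) auto
    qed (intro exI[of _ 0], auto)
  qed simp
qed

lemma path_value_face:
  assumes "i < length p"
  shows "path_value f p = path_value f (face i p) + f (p ! i)"
proof -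
  obtain xs x ys where "p = xs @ x # ys" "p ! i = x" "face i p = xs @ ys"
    by (rule split_at_nth[OF assms])
  then show ?thesis
    by (simp only: path_value_def) simp
qed

text \<open>Deleting position \<open>i\<close> lowers the value by exactly \<open>f (p ! i)\<close>,
  so the value is kept precisely when a zero of \<open>f\<close> is deleted.\<close>

lemma equal_value_face_iff:
  "length p = Suc (length q) \<and> strict_subseq q p \<and> path_value f p = path_value f q \<longleftrightarrow>
     (\<exists>i<length p. q = face i p \<and> f (p ! i) = 0)"
proof -
  have "length p = Suc (length q) \<and> strict_subseq q p \<longleftrightarrow> subseq q p \<and> length p = Suc (length q)"
    unfolding strict_subseq_def by (metis n_not_Suc_n)
  then have "length p = Suc (length q) \<and> strict_subseq q p \<longleftrightarrow> (\<exists>i<length p. q = face i p)"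
    by (simp only: subseq_codim1_iff)
  moreover have "path_value f p = path_value f (face i p) \<longleftrightarrow> f (p ! i) = 0" if "i < length p" for i
    using path_value_face[OF that, of f] by linarith
  ultimately show ?thesis
    by metis
qed

lemma equal_cofaces_iff:
  "\<gamma> \<in> equal_cofaces H f \<alpha> \<longleftrightarrow>
     allowed_path H \<gamma> \<and> (\<exists>i<length \<gamma>. \<alpha> = face i \<gamma> \<and> f (\<gamma> ! i) = 0)"
  unfolding equal_cofaces_def mem_Collect_eq equal_value_face_iff ..

lemma equal_faces_iff:
  "\<beta> \<in> equal_faces H f \<gamma> \<longleftrightarrow>
     allowed_path H \<beta> \<and> (\<exists>i<length \<gamma>. \<beta> = face i \<gamma> \<and> f (\<gamma> ! i) = 0)"
  unfolding equal_faces_def mem_Collect_eq equal_value_face_iff[symmetric]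
  by (simp only: eq_commute[of "path_value f \<beta>"])

lemma set_face:
  assumes "distinct p" "i < length p"
  shows "set (face i p) = set p - {p ! i}"
proof -
  obtain xs x ys where split: "p = xs @ x # ys" "p ! i = x" "face i p = xs @ ys"
    by (rule split_at_nth[OF assms(2)])
  show ?thesis
    unfolding split(2,3) using assms(1) split(1) by auto
qed

lemma length_ge_2_if_face_nonempty: "face i p \<noteq> [] \<Longrightarrow> i < length p \<Longrightarrow> length p \<ge> 2"
  by (cases p; cases "tl p") auto

locale transitive_morse =
  fixes H :: "'v pair_pre_digraph" and f :: "'v \<Rightarrow> real"
  assumes transitive: "transitive_digraph H"
    and morse: "discrete_morse H f"
begin

text \<open>Transitivity turns the condition on consecutive vertices into one on all pairs, which
  survives deletion of a vertex.\<close>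

lemma allowed_path_iff_sorted:
  "allowed_path H p \<longleftrightarrow> p \<noteq> [] \<and> set p \<subseteq> pverts H \<and> sorted_wrt (\<lambda>u v. (u, v) \<in> parcs H) p"
proof -
  have "transp (\<lambda>u v. (u, v) \<in> parcs H)"
    using transitive by (auto simp: transitive_digraph_def transp_trans)
  then show ?thesis
    by (simp add: allowed_path_def successively_conv_sorted_wrt)
qed

lemma allowed_path_distinct:
  assumes "allowed_path H p"
  shows "distinct p"
proof -
  have "(u, u) \<notin> parcs H" for u
    using transitive pair_loopfree_digraph.pair_no_loops[of H "(u, u)"]
    by (auto simp: transitive_digraph_def path_digraph_def pair_digraph_def)
  then show ?thesis
    using assms unfolding allowed_path_iff_sorted
    by (metis distinct_conv_nth linorder_neqE_nat sorted_wrt_nth_less)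
qed

lemma allowed_path_face:
  assumes "allowed_path H p" "i < length p" "length p \<ge> 2"
  shows "allowed_path H (face i p)"
proof -
  obtain xs x ys where split: "p = xs @ x # ys" "face i p = xs @ ys"
    by (rule split_at_nth[OF assms(2)])
  show ?thesis
    unfolding split(2) using assms(1,3) split(1)
    by (auto simp: allowed_path_iff_sorted sorted_wrt_append)
qed

text \<open>Needed to read the bounds on \<open>card\<close> as uniqueness, since an infinite set
  has \<open>card\<close> 0.\<close>

lemma finite_allowed: "finite {p. allowed_path H p \<and> length p = n}"
proof (rule finite_subset)
  show "{p. allowed_path H p \<and> length p = n} \<subseteq> {p. set p \<subseteq> pverts H \<and> length p = n}"
    by (auto simp: allowed_path_def)
  have "finite (pverts H)"
    using transitive by (auto simp: transitive_digraph_def path_digraph_def pair_digraph_def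
        dest: pair_fin_digraph.pair_finite_verts)
  then show "finite {p. set p \<subseteq> pverts H \<and> length p = n}"
    by (rule finite_lists_length_eq)
qed

lemma equal_coface_unique:
  assumes "allowed_path H \<alpha>" "\<gamma> \<in> equal_cofaces H f \<alpha>" "\<delta> \<in> equal_cofaces H f \<alpha>"
  shows "\<gamma> = \<delta>"
proof -
  have "finite (equal_cofaces H f \<alpha>)"
    by (rule finite_subset[OF _ finite_allowed[of "Suc (length \<alpha>)"]])
      (auto simp: equal_cofaces_def)
  moreover have "card (equal_cofaces H f \<alpha>) \<le> 1"
    using morse assms by (auto simp: discrete_morse_def)
  ultimately show ?thesis
    using assms by (auto simp: card_le_Suc0_iff_eq)
qed

lemma equal_face_unique:
  assumes "allowed_path H \<alpha>" "\<beta> \<in> equal_faces H f \<alpha>" "\<delta> \<in> equal_faces H f \<alpha>"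
  shows "\<beta> = \<delta>"
proof -
  have "finite (equal_faces H f \<alpha>)"
    by (rule finite_subset[OF _ finite_allowed[of "length \<alpha> - 1"]])
      (auto simp: equal_faces_def)
  moreover have "card (equal_faces H f \<alpha>) \<le> 1"
    using morse assms by (auto simp: discrete_morse_def)
  ultimately show ?thesis
    using assms by (auto simp: card_le_Suc0_iff_eq)
qed

text \<open>The vertices are distinct, so the vertex missing from the face determines the
  position.\<close>

lemma inj_on_face:
  assumes "allowed_path H p" "i < length p" "j < length p" "face i p = face j p"
  shows "i = j"
proof -
  have d: "distinct p"
    using assms allowed_path_distinct by blast
  then have "set p - {p ! i} = set p - {p ! j}"
    using set_face assms by metis
  then have "p ! i = p ! j"
    using assms by (metis Diff_iff insert_iff nth_mem singletonD)
  then show ?thesis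
    using d assms by (simp add: nth_eq_iff_index_eq)
qed

text \<open>Two zeros would yield two different equal faces. The length bound keeps these faces
  non-empty and hence allowed.\<close>

lemma zero_vertex_unique:
  assumes p: "allowed_path H p" "length p \<ge> 2"
    and uv: "u \<in> set p" "v \<in> set p" "f u = 0" "f v = 0"
  shows "u = v"
proof -
  obtain i j where ij: "i < length p" "j < length p" "p ! i = u" "p ! j = v"
    using uv by (metis in_set_conv_nth)
  have "face i p \<in> equal_faces H f p" "face j p \<in> equal_faces H f p"
    using p uv ij by (auto simp: equal_faces_iff intro: allowed_path_face)
  then have "face i p = face j p"
    using equal_face_unique p by blast
  then show ?thesis
    using inj_on_face p ij by blast
qed

text \<open>The inserted vertex would be a second zero in the longer path.\<close>

lemma no_coface_if_zero_vertex:
  assumes "u \<in> set p" "f u = 0"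
  shows "equal_cofaces H f p = {}"
proof (rule ccontr)
  assume "equal_cofaces H f p \<noteq> {}"
  then obtain q where "q \<in> equal_cofaces H f p"
    by blast
  then obtain i where q: "allowed_path H q" "i < length q" "p = face i q" "f (q ! i) = 0"
    unfolding equal_cofaces_iff by blast
  then have "set p = set q - {q ! i}"
    using set_face allowed_path_distinct by blast
  moreover have "length q \<ge> 2"
    by (rule length_ge_2_if_face_nonempty[OF _ q(2)]) (use q(3) assms(1) in force)
  ultimately show False
    using zero_vertex_unique[of q u "q ! i"] q assms by auto
qed

section \<open>The gradient on elementary paths\<close>

lemma grad_elem_eq_0: "equal_cofaces H f \<alpha> = {} \<Longrightarrow> grad H f (elem \<alpha>) = 0"
  by (simp add: grad_def grad_elem_def)

text \<open>The faces of an allowed path are pairwise different, so no terms of the boundary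
  merge.\<close>

lemma lookup_boundary_elem_face:
  assumes "allowed_path H p" "i < length p" "length p \<ge> 2"
  shows "Poly_Mapping.lookup (boundary_elem p) (face i p) = (- 1) ^ i"
proof -
  have "Poly_Mapping.lookup (boundary_elem p) q =
      (\<Sum>j<length p. (- 1) ^ j * (if face j p = q then 1 else 0))" for q
    using assms(3) by (simp add: boundary_elem_def lookup_sum lookup_single when_def)
  then have "Poly_Mapping.lookup (boundary_elem p) (face i p) =
      (\<Sum>j<length p. (- 1) ^ j * (if face j p = face i p then 1 else 0))" .
  also have "\<dots> = (\<Sum>j<length p. if j = i then (- 1) ^ j else 0)"
  proof (rule sum.cong[OF refl])
    fix j assume "j \<in> {..<length p}"
    then have "face j p = face i p \<longleftrightarrow> j = i"
      using inj_on_face[OF assms(1) _ assms(2)] by blast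
    then show "(- 1 :: real) ^ j * (if face j p = face i p then 1 else 0) = (if j = i then (- 1) ^ j else 0)"
      by (simp only:) simp
  qed
  finally show ?thesis
    using assms by simp
qed

text \<open>Uniqueness of the equal coface evaluates the \<open>THE\<close>, and the inner product
  is the coefficient \<open>(- 1) ^ i\<close> of the face in the boundary.\<close>

lemma grad_elem_face:
  assumes \<gamma>: "allowed_path H \<gamma>" "length \<gamma> \<ge> 2" and i: "i < length \<gamma>" "f (\<gamma> ! i) = 0"
  shows "grad H f (elem (face i \<gamma>)) = - ((- 1) ^ i) *\<^sub>R elem \<gamma>"
proof -
  have \<alpha>: "allowed_path H (face i \<gamma>)"
    using allowed_path_face \<gamma> i by blast
  have mem: "\<gamma> \<in> equal_cofaces H f (face i \<gamma>)"
    using \<gamma> i by (auto simp: equal_cofaces_iff)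
  then have "(THE \<delta>. \<delta> \<in> equal_cofaces H f (face i \<gamma>)) = \<gamma>"
    using equal_coface_unique[OF \<alpha>] by blast
  moreover have "chain_inner x (elem p) = Poly_Mapping.lookup x p" for x :: "'v chain" and p
    by (simp add: chain_inner_def lookup_single when_def if_distrib in_keys_iff cong: if_cong)
  ultimately show ?thesis
    using \<alpha> mem lookup_boundary_elem_face[OF \<gamma>(1) i(1) \<gamma>(2)]
    by (auto simp: grad_def grad_elem_def)
qed

text \<open>Every face except the \<open>i\<close>th keeps the zero of \<open>f\<close> and is
  therefore killed by \<open>V\<close>; in the surviving term the two signs multiply to -1.\<close>

lemma grad_boundary_elem:
  assumes \<gamma>: "allowed_path H \<gamma>" "length \<gamma> \<ge> 2" and i: "i < length \<gamma>" "f (\<gamma> ! i) = 0"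
  shows "grad H f (boundary (elem \<gamma>)) = - elem \<gamma>"
proof -
  have "grad H f (elem (face j \<gamma>)) = 0" if j: "j < length \<gamma>" "j \<noteq> i" for j
  proof (intro grad_elem_eq_0 no_coface_if_zero_vertex)
    show "\<gamma> ! i \<in> set (face j \<gamma>)"
      using \<gamma> i j by (simp only: set_face allowed_path_distinct)
        (auto simp: nth_eq_iff_index_eq allowed_path_distinct)
  qed (rule i)
  note * = this
  have "grad H f (boundary (elem \<gamma>)) = (\<Sum>j<length \<gamma>. (- 1) ^ j *\<^sub>R grad H f (elem (face j \<gamma>)))"
    using \<gamma> by (simp add: boundary_elem_def linear_sum[OF linear_grad] linear_scale[OF linear_grad])
  also have "\<dots> = (\<Sum>j<length \<gamma>. if j = i then (- 1) ^ i *\<^sub>R grad H f (elem (face i \<gamma>)) else 0)"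
    by (rule sum.cong[OF refl]) (simp add: *)
  finally show ?thesis
    using i grad_elem_face[OF \<gamma> i] by (simp flip: power_add)
qed

lemma grad_elem_cases:
  obtains (zero) "grad H f (elem \<alpha>) = 0"
  | (coface) \<gamma> i where "allowed_path H \<gamma>" "length \<gamma> \<ge> 2" "i < length \<gamma>" "f (\<gamma> ! i) = 0"
      "\<alpha> = face i \<gamma>"
proof (cases "allowed_path H \<alpha> \<and> equal_cofaces H f \<alpha> \<noteq> {}")
  case True
  then obtain \<gamma> where "\<gamma> \<in> equal_cofaces H f \<alpha>"
    by blast
  then obtain i where \<gamma>: "allowed_path H \<gamma>" "i < length \<gamma>" "f (\<gamma> ! i) = 0" "\<alpha> = face i \<gamma>"
    unfolding equal_cofaces_iff by blast
  moreover have "\<alpha> \<noteq> []"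
    using True by (auto simp: allowed_path_def)
  then have "length \<gamma> \<ge> 2"
    unfolding \<gamma>(4) by (rule length_ge_2_if_face_nonempty[OF _ \<gamma>(2)])
  ultimately show ?thesis
    using coface by blast
next
  case False
  then show ?thesis
    using zero by (auto simp: grad_def grad_elem_def)
qed

lemma grad_elem_zero_vertex:
  assumes "i < length \<gamma>" "f (\<gamma> ! i) = 0"
  shows "grad H f (elem \<gamma>) = 0"
  using assms by (intro grad_elem_eq_0 no_coface_if_zero_vertex[of "\<gamma> ! i"]) auto

text \<open>A path produced by \<open>V\<close> contains a zero of \<open>f\<close>, which rules out
  a further equal coface.\<close>

lemma grad_grad: "grad H f (grad H f x) = 0"
proof (rule linear_eq_on_keys[where g = "\<lambda>x. grad H f (grad H f x)" and h = "\<lambda>_. 0"])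
  show "linear (\<lambda>x. grad H f (grad H f x))"
    by (rule linear_compose[OF linear_grad linear_grad, unfolded o_def])
  show "grad H f (grad H f (elem p)) = 0" for p
    by (cases p rule: grad_elem_cases)
      (simp_all add: linear_0[OF linear_grad] grad_elem_face grad_elem_zero_vertex
        linear_scale[OF linear_grad] linear_neg[OF linear_grad])
qed (rule linear_zero)

text \<open>On a path with equal coface \<gamma>, \<open>V\<close> gives a multiple of \<gamma>, and
  \<open>V \<partial>\<close> acts on \<gamma> as -1.\<close>

lemma grad_boundary_grad: "grad H f (boundary (grad H f x)) = - grad H f x"
proof (rule linear_eq_on_keys[where g = "\<lambda>x. grad H f (boundary (grad H f x))" and h = "\<lambda>x. - grad H f x"])
  show "linear (\<lambda>x. grad H f (boundary (grad H f x)))"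
    using linear_compose[OF linear_compose[OF linear_grad linear_boundary] linear_grad]
    by (simp add: o_def)
  show "linear (\<lambda>x. - grad H f x)"
    by (rule linear_compose_neg[OF linear_grad])
  show "grad H f (boundary (grad H f (elem p))) = - grad H f (elem p)" for p
  proof (cases p rule: grad_elem_cases)
    case zero
    then show ?thesis
      by (simp add: linear_0[OF linear_grad] linear_0[OF linear_boundary])
  next
    case (coface \<gamma> i)
    then show ?thesis
      using grad_boundary_elem[OF coface(1-4)] grad_elem_face[OF coface(1-4)]
      by (simp add: linear_scale[OF linear_grad] linear_neg[OF linear_grad]
          linear_scale[OF linear_boundary] linear_neg[OF linear_boundary])
  qed
qed

section \<open>Idempotence of the flow and its stabilization\<close>

lemma grad_flow: "grad H f (flow H f x) = 0"
  \<comment> \<open>Applying \<open>V\<close> to the three terms of \<open>\<Phi> x\<close> gives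
    \<open>V x\<close>, \<open>- V x\<close> and 0.\<close>
  by (simp add: flow_def linear_add[OF linear_grad] grad_boundary_grad grad_grad)

lemma boundary_flow: "boundary (flow H f x) = flow H f (boundary x)"
  by (simp add: flow_def linear_add[OF linear_boundary] boundary_boundary linear_0[OF linear_grad])

text \<open>Both correction terms vanish on \<open>\<Phi> x\<close>: one contains
  \<open>V \<Phi> x\<close>, the other
  \<open>V \<partial> \<Phi> x = V \<Phi> \<partial> x\<close>.\<close>

lemma flow_flow: "flow H f (flow H f x) = flow H f x"
proof -
  have "flow H f (flow H f x) = flow H f x + grad H f (flow H f (boundary x))"
    by (subst flow_def) (simp add: grad_flow boundary_flow linear_0[OF linear_boundary])
  then show ?thesis
    by (simp add: grad_flow)
qed

text \<open>Exponent 1 is stable by idempotence, but the least stable exponent may be 0, and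
  stability is tested on allowed chains only. Off those chains just the alternative is known, which
  suffices for linearity.\<close>

lemma flow_infty_cases: "flow_infty H f = id \<or> flow_infty H f = flow H f"
  and flow_infty_P_space: "x \<in> P_space H n \<Longrightarrow> flow_infty H f x = flow H f x"
proof -
  let ?stable = "\<lambda>N. \<forall>k\<ge>N. \<forall>n. \<forall>x\<in>P_space H n. (flow H f ^^ k) x = (flow H f ^^ N) x"
  define N where "N = (LEAST N. ?stable N)"
  have pow: "(flow H f ^^ Suc k) x = flow H f x" for k :: nat and x
    by (induction k) (simp_all add: flow_flow)
  have "?stable 1"
  proof (intro allI impI ballI)
    fix k n :: nat and x assume "1 \<le> k"
    then show "(flow H f ^^ k) x = (flow H f ^^ 1) x"
      using pow[of "k - 1" x] by simp
  qed
  then have N: "?stable N" "N \<le> 1"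
    unfolding N_def by (rule LeastI, rule Least_le)
  have eq: "flow_infty H f = flow H f ^^ N"
    unfolding flow_infty_def N_def ..
  show "flow_infty H f = id \<or> flow_infty H f = flow H f"
    using N(2) by (auto simp: eq le_Suc_eq)
  show "flow_infty H f x = flow H f x" if "x \<in> P_space H n"
  proof -
    have "(flow H f ^^ 1) x = (flow H f ^^ N) x"
      using N that by blast
    then show ?thesis
      by (simp add: eq)
  qed
qed

lemma linear_flow_infty: "linear (flow_infty H f)"
  using flow_infty_cases linear_flow[of H f] linear_id by auto

section \<open>Projection to critical paths, an inverse of the flow between critical and fixed
  chains\<close>

definition crit_part :: "'v chain \<Rightarrow> 'v chain" where
  "crit_part = lin_ext (\<lambda>p. if critical_path H f p then elem p else 0)"

lemma linear_crit_part: "linear crit_part"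
  by (simp add: crit_part_def linear_lin_ext)

lemma lookup_crit_part:
  "Poly_Mapping.lookup (crit_part x) p =
     (if critical_path H f p then Poly_Mapping.lookup x p else 0)"
proof -
  have "Poly_Mapping.lookup (crit_part x) p = (\<Sum>q\<in>Poly_Mapping.keys x.
      Poly_Mapping.lookup x q * Poly_Mapping.lookup (if critical_path H f q then elem q else 0) p)"
    by (simp add: crit_part_def lin_ext_def lookup_sum)
  also have "\<dots> = (\<Sum>q\<in>Poly_Mapping.keys x. if q = p then
        (if critical_path H f p then Poly_Mapping.lookup x p else 0) else 0)"
    by (rule sum.cong[OF refl]) (simp add: lookup_single when_def)
  finally show ?thesis
    by (simp add: in_keys_iff)
qed

lemma crit_part_eq_self: "x \<in> Crit_space H f n \<Longrightarrow> crit_part x = x"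
  by (rule poly_mapping_eqI) (auto simp: lookup_crit_part Crit_space_iff in_keys_iff)

text \<open>A path produced by \<open>V\<close> has an equal face, namely the path it came from, so
  it is not critical.\<close>

lemma crit_part_grad: "crit_part (grad H f x) = 0"
proof (rule linear_eq_on_keys[where g = "\<lambda>x. crit_part (grad H f x)" and h = "\<lambda>_. 0"])
  show "linear (\<lambda>x. crit_part (grad H f x))"
    by (rule linear_compose[OF linear_grad linear_crit_part, unfolded o_def])
  show "crit_part (grad H f (elem p)) = 0" for p
  proof (cases p rule: grad_elem_cases)
    case zero
    then show ?thesis
      by (simp add: linear_0[OF linear_crit_part])
  next
    case (coface \<gamma> i)
    then have "face i \<gamma> \<in> equal_faces H f \<gamma>"
      unfolding equal_faces_iff using allowed_path_face by blast
    then have "\<not> critical_path H f \<gamma>"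
      by (auto simp: critical_path_def)
    then have "crit_part (elem \<gamma>) = 0"
      by (simp add: crit_part_def)
    then show ?thesis
      using grad_elem_face coface
      by (simp add: linear_scale[OF linear_crit_part] linear_neg[OF linear_crit_part])
  qed
qed (rule linear_zero)

text \<open>A critical chain has \<open>V x = 0\<close>, which leaves
  \<open>\<Phi> x = x + V \<partial> x\<close>, and the projection kills the second term.\<close>

lemma crit_part_flow:
  assumes "x \<in> Crit_space H f n"
  shows "crit_part (flow H f x) = x"
proof -
  have "grad H f x = 0"
    by (rule linear_eq_on_keys[OF linear_grad linear_zero])
      (use assms in \<open>auto simp: Crit_space_iff critical_path_def intro!: grad_elem_eq_0\<close>)
  then show ?thesis
    using crit_part_eq_self[OF assms]
    by (simp add: flow_def linear_add[OF linear_crit_part] crit_part_grad linear_0[OF linear_boundary])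
qed

text \<open>Different paths cannot share an equal coface, so the coefficient of \<alpha> in
  \<open>x\<close> reappears up to sign as the coefficient of its coface in
  \<open>V x\<close>.\<close>

lemma lookup_eq_0_if_grad_eq_0:
  assumes x: "x \<in> P_space H n" "grad H f x = 0" and "equal_cofaces H f \<alpha> \<noteq> {}"
  shows "Poly_Mapping.lookup x \<alpha> = 0"
proof (rule ccontr)
  assume "Poly_Mapping.lookup x \<alpha> \<noteq> 0"
  then have \<alpha>: "\<alpha> \<in> Poly_Mapping.keys x"
    by (simp add: in_keys_iff)
  then have "\<alpha> \<noteq> []"
    using x by (auto simp: P_space_iff allowed_path_def)
  obtain \<gamma> where "\<gamma> \<in> equal_cofaces H f \<alpha>"
    using assms(3) by blast
  then obtain i where "allowed_path H \<gamma>" "i < length \<gamma>" "f (\<gamma> ! i) = 0" "\<alpha> = face i \<gamma>"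
    unfolding equal_cofaces_iff by blast
  moreover from this have "length \<gamma> \<ge> 2"
    using \<open>\<alpha> \<noteq> []\<close> length_ge_2_if_face_nonempty by metis
  ultimately have \<gamma>: "allowed_path H \<gamma>" "length \<gamma> \<ge> 2" "i < length \<gamma>"
      "f (\<gamma> ! i) = 0" "\<alpha> = face i \<gamma>"
    by (simp_all only:)
  \<comment> \<open>A path \<gamma> has only one zero of \<open>f\<close>; deleting it recovers
    \<alpha>, so no other path is sent to a multiple of \<gamma>.\<close>
  have other: "Poly_Mapping.lookup (grad H f (elem p)) \<gamma> = 0" if "p \<noteq> \<alpha>" for p
  proof (cases p rule: grad_elem_cases)
    case (coface \<delta> j)
    have "\<delta> \<noteq> \<gamma>"
    proof
      assume "\<delta> = \<gamma>"
      then have "\<delta> ! j = \<gamma> ! i"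
        using zero_vertex_unique[OF \<gamma>(1,2), of "\<delta> ! j" "\<gamma> ! i"] \<gamma>(3,4) coface(3,4) by simp
      then have "j = i"
        using \<open>\<delta> = \<gamma>\<close> \<gamma>(3) coface(3) nth_eq_iff_index_eq[OF allowed_path_distinct[OF \<gamma>(1)]]
        by simp
      then show False
        using that \<open>\<delta> = \<gamma>\<close> \<gamma>(5) coface(5) by simp
    qed
    then show ?thesis
      unfolding coface(5) grad_elem_face[OF coface(1-4)] by (simp add: lookup_single when_def)
  qed simp
  have "0 = Poly_Mapping.lookup (grad H f x) \<gamma>"
    using x by simp
  also have "grad H f x =
      (\<Sum>p\<in>Poly_Mapping.keys x. Poly_Mapping.lookup x p *\<^sub>R grad H f (elem p))"
    by (simp add: grad_def lin_ext_def)
  also have "Poly_Mapping.lookup \<dots> \<gamma> =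
      (\<Sum>p\<in>Poly_Mapping.keys x. if p = \<alpha> then
        Poly_Mapping.lookup x \<alpha> * Poly_Mapping.lookup (grad H f (elem \<alpha>)) \<gamma> else 0)"
    unfolding lookup_sum by (rule sum.cong[OF refl]) (use other in auto)
  also have "\<dots> = Poly_Mapping.lookup x \<alpha> * - ((- 1) ^ i)"
    unfolding grad_elem_face[OF \<gamma>(1-4), folded \<gamma>(5)] using \<alpha> by simp
  finally show False
    using \<alpha> by (simp add: in_keys_iff)
qed

text \<open>The difference \<open>x - crit_part x\<close> is supported on non-critical paths of
  \<open>x\<close>, and \<Phi> annihilates each of these.\<close>

lemma flow_crit_part:
  assumes x: "x \<in> P_space H n" "flow H f x = x"
  shows "flow H f (crit_part x) = x"
proof -
  have g: "grad H f x = 0"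
    using grad_flow[of x] x by simp
  have "flow H f (x - crit_part x) = 0"
  proof (rule linear_eq_on_keys[OF linear_flow linear_zero])
    fix p assume p: "p \<in> Poly_Mapping.keys (x - crit_part x)"
    then have "Poly_Mapping.lookup x p \<noteq> 0" and ncrit: "\<not> critical_path H f p"
      by (auto simp: in_keys_iff lookup_minus lookup_crit_part split: if_splits)
    then have "equal_cofaces H f p = {}" and ap: "allowed_path H p"
      using lookup_eq_0_if_grad_eq_0[OF x(1) g] x(1) by (auto simp: P_space_iff in_keys_iff)
    \<comment> \<open>Since \<open>V x = 0\<close> excludes equal cofaces, a non-critical path of
      \<open>x\<close> must have an equal face.\<close>
    then obtain q where "q \<in> equal_faces H f p"
      using ncrit unfolding critical_path_def by blast
    then obtain i where i: "i < length p" "f (p ! i) = 0" "allowed_path H (face i p)"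
      unfolding equal_faces_iff by blast
    then have "length p \<ge> 2"
      unfolding allowed_path_def by (intro length_ge_2_if_face_nonempty) auto
    \<comment> \<open>The path contains a zero, so \<open>V p = 0\<close> and
      \<open>V \<partial> p = - p\<close>; hence \<open>\<Phi> p = p - p\<close>.\<close>
    then show "flow H f (elem p) = 0"
      using grad_boundary_elem[OF ap _ i(1,2)] grad_elem_zero_vertex[OF i(1,2)]
      unfolding flow_def by (simp add: linear_0[OF linear_boundary])
  qed
  then show ?thesis
    using x by (simp add: linear_diff[OF linear_flow])
qed

end

section \<open>The Morse complex of an invariant subcomplex\<close>

text \<open>A critical chain in \<open>P_space G n\<close> may lie outside \<Omega>(G), so
  \<open>flow_morse\<close> is assumed alongside \<open>grad_Omega\<close>.\<close>

locale invariant_morse = transitive_morse H f for H :: "'v pair_pre_digraph" and f +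
  fixes G :: "'v pair_pre_digraph"
  assumes verts_le: "pverts G \<subseteq> pverts H"
    and arcs_le: "parcs G \<subseteq> parcs H"
    and grad_Omega: "x \<in> Omega_space G n \<Longrightarrow> grad H f x \<in> Omega_space G (Suc n)"
    and flow_morse: "x \<in> morse_space G H f n \<Longrightarrow> flow H f x \<in> Omega_space G n"
begin

lemma P_space_mono: "x \<in> P_space G n \<Longrightarrow> x \<in> P_space H n"
  using verts_le arcs_le by (auto simp: P_space_iff allowed_path_def elim!: successively_mono)

lemma Omega_P_space: "x \<in> Omega_space G n \<Longrightarrow> x \<in> P_space H n"
  by (auto simp: Omega_space_def intro: P_space_mono)

lemma flow_Omega:
  assumes "x \<in> Omega_space G n"
  shows "flow H f x \<in> Omega_space G n"
proof -
  have "boundary (grad H f x) \<in> Omega_space G n"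
    using boundary_Omega_space[OF grad_Omega[OF assms]] by simp
  moreover have "grad H f (boundary x) \<in> Omega_space G n"
  \<comment> \<open>In degree 0 the index \<open>n - 1\<close> truncates, so
    \<open>grad_Omega\<close> would land in degree 1; there \<open>\<partial> x = 0\<close> is used
    instead.\<close>
  proof (cases n)
    case 0
    then have "boundary x = 0"
      using assms by (auto simp: Omega_space_def intro: boundary_P_space_0)
    then show ?thesis
      by (simp add: linear_0[OF linear_grad] subspace_0 subspace_Omega_space)
  next
    case (Suc k)
    then show ?thesis
      using grad_Omega[OF boundary_Omega_space[OF assms]] by simp
  qed
  ultimately show ?thesis
    using assms by (simp add: flow_def subspace_add subspace_Omega_space)
qed

lemma flow_infty_morse: "x \<in> morse_space G H f n \<Longrightarrow> flow_infty H f x = flow H f x"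
  by (auto simp: morse_space_def intro: flow_infty_P_space P_space_mono)

lemma inj_on_flow_infty: "inj_on (flow_infty H f) (morse_space G H f n)"
  by (rule inj_on_inverseI[of _ crit_part])
    (auto simp: flow_infty_morse morse_space_def intro: crit_part_flow flow_infty_P_space P_space_mono)

text \<open>The projection only drops paths, so it stays in \<open>P_space G n\<close>.\<close>

lemma crit_part_morse_space: "x \<in> Omega_space G n \<Longrightarrow> crit_part x \<in> morse_space G H f n"
  by (auto simp: Omega_space_def morse_space_def P_space_iff Crit_space_iff in_keys_iff
      lookup_crit_part split: if_splits)

text \<open>With the injectivity of \<open>flow_infty\<close>, this makes \<open>crit_part\<close>
  its inverse on the fixed chains in \<Omega>(G).\<close>

lemma flow_infty_crit_part:
  assumes "x \<in> Omega_space G n" "flow H f x = x"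
  shows "flow_infty H f (crit_part x) = x"
  using flow_infty_morse[OF crit_part_morse_space[OF assms(1)]]
    flow_crit_part[OF Omega_P_space[OF assms(1)] assms(2)] by simp

text \<open>Since \<partial> commutes with \<Phi>, the chain \<open>\<partial> \<Phi> x\<close> is a
  fixed chain in \<Omega>(G). Its critical part is a preimage, and injectivity identifies it with
  the value of \<open>inv_into\<close>.\<close>

lemma morse_boundary_Suc:
  assumes "x \<in> morse_space G H f (Suc k)"
  shows "morse_boundary G H f (Suc k) x = crit_part (boundary (flow H f x))"
    and "crit_part (boundary (flow H f x)) \<in> morse_space G H f k"
    and "flow_infty H f (crit_part (boundary (flow H f x))) = boundary (flow_infty H f x)"
proof -
  have bd: "boundary (flow H f x) \<in> Omega_space G k"
    using boundary_Omega_space[OF flow_morse[OF assms]] by simp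
  then show mem: "crit_part (boundary (flow H f x)) \<in> morse_space G H f k"
    by (rule crit_part_morse_space)
  show eq: "flow_infty H f (crit_part (boundary (flow H f x))) = boundary (flow_infty H f x)"
    using flow_infty_crit_part[OF bd] flow_infty_morse[OF assms]
    by (simp add: boundary_flow[symmetric] flow_flow)
  show "morse_boundary G H f (Suc k) x = crit_part (boundary (flow H f x))"
    using inv_into_f_eq[OF inj_on_flow_infty mem eq] by (simp add: morse_boundary_def)
qed

lemma subspace_morse_space: "subspace (morse_space G H f n)"
  by (simp add: morse_space_def Crit_space_def subspace_P_space subspace_inter)

lemma linear_morse_differential: "linear (\<lambda>x. crit_part (boundary (flow H f x)))"
  using linear_compose[OF linear_compose[OF linear_flow linear_boundary] linear_crit_part]
  by (simp add: o_def)

text \<open>On the Morse space the differential agrees with a map that is linear on all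
  chains.\<close>

lemma subspace_morse_boundaries:
  "subspace (boundaries (morse_space G H f) (morse_boundary G H f) m)"
proof -
  have "boundaries (morse_space G H f) (morse_boundary G H f) m =
      (\<lambda>x. crit_part (boundary (flow H f x))) ` morse_space G H f (Suc m)"
    using morse_boundary_Suc by (auto simp: boundaries_def)
  then show ?thesis
    using linear_subspace_image[OF linear_morse_differential subspace_morse_space] by simp
qed

text \<open>In degree 0 both differentials vanish, so the condition on the right is void there.\<close>

lemma morse_cycles_iff:
  "x \<in> cycles (morse_space G H f) (morse_boundary G H f) m \<longleftrightarrow>
     x \<in> morse_space G H f m \<and> boundary (flow_infty H f x) = 0"
proof (cases m)
  case 0
  have "boundary (flow_infty H f x) = 0" if "x \<in> morse_space G H f 0"
    using flow_morse[OF that] flow_infty_morse[OF that]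
    by (auto simp: Omega_space_def intro: boundary_P_space_0)
  then show ?thesis
    using 0 by (auto simp: cycles_def morse_boundary_def)
next
  case (Suc k)
  \<comment> \<open>\<open>flow_infty\<close> and \<open>crit_part\<close> carry the two boundaries
    into each other, and both maps are linear.\<close>
  have "morse_boundary G H f (Suc k) x = 0 \<longleftrightarrow> boundary (flow_infty H f x) = 0"
    if x: "x \<in> morse_space G H f (Suc k)"
    using morse_boundary_Suc[OF x] flow_infty_morse[OF x]
    by (metis linear_0 linear_crit_part linear_flow_infty)
  then show ?thesis
    using Suc by (auto simp: cycles_def)
qed

lemma subspace_morse_cycles: "subspace (cycles (morse_space G H f) (morse_boundary G H f) m)"
proof -
  have lin: "linear (\<lambda>x. boundary (flow_infty H f x))"
    using linear_compose[OF linear_flow_infty linear_boundary] by (simp add: o_def)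
  have "cycles (morse_space G H f) (morse_boundary G H f) m =
      morse_space G H f m \<inter> {x. boundary (flow_infty H f x) = 0}"
    using morse_cycles_iff by blast
  then show ?thesis
    using subspace_inter[OF subspace_morse_space linear_subspace_kernel[OF lin]] by simp
qed

text \<open>The isomorphism is induced by \<open>flow_infty H f\<close>, a chain map into
  \<Omega>(G).\<close>

lemma morse_homology_iso:
  "real_module_iso (homology (morse_space G H f) (morse_boundary G H f) m) (path_homology G m)"
  unfolding path_homology_def
proof (rule real_module_iso_homology[OF linear_flow_infty subspace_morse_cycles
      subspace_morse_boundaries])
  let ?C = "morse_space G H f" and ?d = "morse_boundary G H f"
  let ?BD = "boundaries (Omega_space G) (\<lambda>n. boundary) m"
  show "subspace ?BD"
    by (simp add: boundaries_def linear_subspace_image linear_boundary subspace_Omega_space)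
  show "flow_infty H f x \<in> cycles (Omega_space G) (\<lambda>n. boundary) m" if "x \<in> cycles ?C ?d m" for x
    using that flow_morse[of x m] flow_infty_morse[of x m] unfolding morse_cycles_iff
    by (auto simp: cycles_def)
  show "flow_infty H f x \<in> ?BD" if "x \<in> boundaries ?C ?d m" for x
    using that by (auto simp: boundaries_def morse_boundary_Suc flow_infty_morse intro: flow_morse)
  show "x \<in> boundaries ?C ?d m" if x: "x \<in> cycles ?C ?d m" and bd: "flow_infty H f x \<in> ?BD" for x
  proof -
    have xC: "x \<in> ?C m"
      using x by (simp add: cycles_def)
    obtain w where w: "w \<in> Omega_space G (Suc m)" "flow_infty H f x = boundary w"
      using bd by (auto simp: boundaries_def)
    \<comment> \<open>Applying \<Phi> to \<open>flow_infty H f x = boundary w\<close> replaces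
      \<open>w\<close> by the fixed chain \<open>\<Phi> w\<close>, which is the image of its
      critical part \<open>z\<close>; injectivity then gives \<open>x\<close> as the Morse boundary
      of \<open>z\<close>.\<close>
    define z where "z = crit_part (flow H f w)"
    have fw: "flow H f w \<in> Omega_space G (Suc m)"
      using w flow_Omega by blast
    then have z: "z \<in> ?C (Suc m)" "flow_infty H f z = flow H f w"
      unfolding z_def by (simp_all add: crit_part_morse_space flow_infty_crit_part flow_flow)
    have "flow_infty H f (?d (Suc m) z) = boundary (flow H f w)"
      using morse_boundary_Suc[OF z(1)] z(2) by simp
    also have "\<dots> = flow H f (flow_infty H f x)"
      by (simp add: boundary_flow w)
    also have "\<dots> = flow_infty H f x"
      using xC by (simp add: flow_infty_morse flow_flow)
    finally have "x = ?d (Suc m) z"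
      using inj_on_flow_infty[of m] xC morse_boundary_Suc(1,2)[OF z(1)]
      by (auto dest: inj_onD)
    then show ?thesis
      using z(1) by (simp add: boundaries_def)
  qed
  show "\<exists>x\<in>cycles ?C ?d m. flow_infty H f x - y \<in> ?BD"
    if y: "y \<in> cycles (Omega_space G) (\<lambda>n. boundary) m" for y
  proof
    have yO: "y \<in> Omega_space G m" and y0: "boundary y = 0"
      using y by (auto simp: cycles_def)
    \<comment> \<open>The cycle \<open>y\<close> itself need not be fixed, so the preimage is taken
      of the fixed chain \<open>\<Phi> y\<close>.\<close>
    define x where "x = crit_part (flow H f y)"
    have x: "x \<in> ?C m" "flow_infty H f x = flow H f y"
      unfolding x_def using flow_Omega[OF yO]
      by (simp_all add: crit_part_morse_space flow_infty_crit_part flow_flow)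
    have "flow H f 0 = 0"
      by (rule linear_0[OF linear_flow])
    then show "x \<in> cycles ?C ?d m"
      using x y0 by (simp add: morse_cycles_iff boundary_flow)
    \<comment> \<open>The homotopy formula at a cycle: the term \<open>V \<partial> y\<close>
      vanishes.\<close>
    have "flow_infty H f x - y = boundary (grad H f y)"
      using x y0 by (simp add: flow_def linear_0[OF linear_grad])
    then show "flow_infty H f x - y \<in> ?BD"
      using grad_Omega[OF yO] by (simp add: boundaries_def)
  qed
qed

end

theorem corollary4p11:
  fixes G H :: "'v pair_pre_digraph" and f :: "'v \<Rightarrow> real"
  assumes "path_digraph G"
    and "is_transitive_closure H G"
    and "discrete_morse H f"
    and "\<forall>n. grad H f ` Omega_space G n \<subseteq> Omega_space G (Suc n)"
    and "\<forall>n. \<forall>\<alpha>\<in>Crit_space H f n \<inter> P_space G n. flow H f \<alpha> \<in> Omega_space G n"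
  shows "\<forall>m. real_module_iso (homology (morse_space G H f) (morse_boundary G H f) m)
                             (path_homology G m)"
proof -
  interpret invariant_morse H f G
    using assms by unfold_locales (auto simp: is_transitive_closure_def morse_space_def)
  show ?thesis
    using morse_homology_iso by blast
qed

end
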